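(* For every integer $k\geq 2$, the graph $H_{2k-2}$ satisfies $w(H_{2k-2})=2k$, $2|L_e(H_{2k-2})|+2=\ell_e(H_{2k-2})=2k+2$, and $\chi(H_{2k-2})=2k+1=2|L_e(H_{2k-2})|+1=\ell_e(H_{2k-2})-1$. In particular $w(H_{2k-2})=2|L_e(H_{2k-2})|$ but $\chi(H_{2k-2})=2|L_e(H_{2k-2})|+1$.
   Context: For an integer $i\geq 1$, $H_i$ denotes the graph obtained from the disjoint union of the complete graph $K_i$ and the 5-cycle $C_5$ by adding all edges between $K_i$ and $C_5$. $L_e(G)$ denotes the set of all even integers $m$ such that $G$ contains a cycle of length $m$, and $\ell_e(G)$ the length of a longest even cycle of $G$. $w(G)$ denotes the clique number (the number of vertices of a largest clique) and $\chi(G)$ the chromatic number. *)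

theory Defs
  imports Main
begin

record 'a ugraph =
  verts :: "'a set"
  edges :: "'a set set"

definition simple_graph :: "'a ugraph \<Rightarrow> bool" where
  "simple_graph G \<longleftrightarrow> finite (verts G) \<and> (\<forall>e\<in>edges G. e \<subseteq> verts G \<and> card e = 2)"

definition complete_graph :: "nat \<Rightarrow> nat ugraph" where
  "complete_graph n = \<lparr>verts = {..<n}, edges = {{i, j} | i j. i < n \<and> j < n \<and> i \<noteq> j}\<rparr>"

definition cycle_graph :: "nat \<Rightarrow> nat ugraph" where
  "cycle_graph n = \<lparr>verts = {..<n}, edges = {{i, (i + 1) mod n} | i. i < n}\<rparr>"

definition disjoint_union :: "'a ugraph \<Rightarrow> 'b ugraph \<Rightarrow> ('a + 'b) ugraph" where
  "disjoint_union G G' =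
     \<lparr>verts = Inl ` verts G \<union> Inr ` verts G',
      edges = (image Inl) ` edges G \<union> (image Inr) ` edges G'\<rparr>"

definition join :: "'a ugraph \<Rightarrow> 'b ugraph \<Rightarrow> ('a + 'b) ugraph" where
  "join G G' =
     \<lparr>verts = verts (disjoint_union G G'),
      edges = edges (disjoint_union G G') \<union>
        {{Inl x, Inr y} | x y. x \<in> verts G \<and> y \<in> verts G'}\<rparr>"

definition H :: "nat \<Rightarrow> (nat + nat) ugraph" where
  "H i = join (complete_graph i) (cycle_graph 5)"

definition is_clique :: "'a ugraph \<Rightarrow> 'a set \<Rightarrow> bool" where
  "is_clique G C \<longleftrightarrow> C \<subseteq> verts G \<and> (\<forall>x\<in>C. \<forall>y\<in>C. x \<noteq> y \<longrightarrow> {x, y} \<in> edges G)"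

definition clique_number :: "'a ugraph \<Rightarrow> nat" where
  "clique_number G = Max {card C | C. is_clique G C}"

definition proper_colouring :: "'a ugraph \<Rightarrow> nat \<Rightarrow> ('a \<Rightarrow> nat) \<Rightarrow> bool" where
  "proper_colouring G n c \<longleftrightarrow>
     (\<forall>x\<in>verts G. c x < n) \<and>
     (\<forall>x\<in>verts G. \<forall>y\<in>verts G. {x, y} \<in> edges G \<longrightarrow> c x \<noteq> c y)"

definition chromatic_number :: "'a ugraph \<Rightarrow> nat" where
  "chromatic_number G = (LEAST n. \<exists>c. proper_colouring G n c)"

(* A cycle is listed without repeating its starting vertex, so its length is the
   length of the list; cycles in a simple graph have at least three vertices. *)
definition is_cycle :: "'a ugraph \<Rightarrow> 'a list \<Rightarrow> bool" where
  "is_cycle G p \<longleftrightarrow>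
     3 \<le> length p \<and> distinct p \<and> set p \<subseteq> verts G \<and>
     (\<forall>i<length p. {p ! i, p ! ((i + 1) mod length p)} \<in> edges G)"

definition even_cycle_lengths :: "'a ugraph \<Rightarrow> nat set" where
  "even_cycle_lengths G = {m. even m \<and> (\<exists>p. is_cycle G p \<and> length p = m)}"

definition longest_even_cycle :: "'a ugraph \<Rightarrow> nat" where
  "longest_even_cycle G = Max (even_cycle_lengths G)"

lemma simple_graph_H: "simple_graph (H i)"
proof -
  have *: "(m + 1) mod 5 \<noteq> m" "(m + 1) mod 5 < 5" if "m < 5" for m :: nat
    using that by presburger+
  show ?thesis
    using * unfolding simple_graph_def H_def join_def disjoint_union_def complete_graph_def
      cycle_graph_def
    by (auto simp: card_insert_if) metis
qed

lemma finite_clique_sizes: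
  assumes "simple_graph G"
  shows "finite {card C | C. is_clique G C}"
proof (rule finite_subset)
  show "{card C | C. is_clique G C} \<subseteq> {..card (verts G)}"
    using assms by (auto simp: simple_graph_def is_clique_def card_mono)
qed simp

lemma finite_even_cycle_lengths:
  assumes "simple_graph G"
  shows "finite (even_cycle_lengths G)"
proof (rule finite_subset)
  show "even_cycle_lengths G \<subseteq> {..card (verts G)}"
    using assms
    by (auto simp: simple_graph_def even_cycle_lengths_def is_cycle_def)
      (metis card_mono distinct_card)
qed simp

end

(* In a join, a clique splits into cliques of the two parts, and the parts use disjoint sets of
   colours; so K_n joined with C_5 has clique number n + 2 and chromatic number n + 3.
   Listing some vertices of K_n and then a path of C_5 gives a cycle, which yields every
   length from 3 to the number n + 5 of vertices. *)
theory Submission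
  imports Defs
begin

section \<open>Vertices and edges of \<open>H n\<close>\<close>

lemma verts_H: "verts (H n) = Inl ` {..<n} \<union> Inr ` {..<5}"
  by (simp add: H_def join_def disjoint_union_def complete_graph_def cycle_graph_def)

lemma card_verts_H: "card (verts (H n)) = n + 5"
  unfolding verts_H by (subst card_Un_disjoint) (auto simp: card_image)

text \<open>No image under \<open>Inr\<close> contains \<open>Inl x\<close>, and a mixed pair
  contains an \<open>Inr\<close> vertex. So such a pair can only be the image of an edge of
  \<open>G\<close>, and injectivity of \<open>Inl\<close> recovers that edge.\<close>

lemma edge_join_Inl_Inl: "{Inl x, Inl y} \<in> edges (join G G') \<longleftrightarrow> {x, y} \<in> edges G"
proof -
  have "{Inl x, Inl y} \<noteq> Inr ` e" for e :: "'b set"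
    by (metis Inl_Inr_False imageE insertI1)
  moreover have "{Inl x, Inl y} \<noteq> {Inl x', Inr y'}" for x' :: 'a and y' :: 'b
    by (metis Inl_Inr_False insert_iff singletonD)
  moreover have "{Inl x, Inl y :: 'a + 'b} = Inl ` e \<longleftrightarrow> e = {x, y}" for e :: "'a set"
    using inj_image_eq_iff[OF inj_Inl, of "{x, y}" e] by auto
  ultimately show ?thesis
    by (simp add: join_def disjoint_union_def image_iff)
qed

lemma edge_join_Inr_Inr: "{Inr x, Inr y} \<in> edges (join G G') \<longleftrightarrow> {x, y} \<in> edges G'"
proof -
  have "{Inr x, Inr y} \<noteq> Inl ` e" for e :: "'a set"
    by (metis Inr_Inl_False imageE insertI1)
  moreover have "{Inr x, Inr y} \<noteq> {Inl x', Inr y'}" for x' :: 'a and y' :: 'b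
    by (metis Inr_Inl_False insert_iff singletonD)
  moreover have "{Inr x, Inr y :: 'a + 'b} = Inr ` e \<longleftrightarrow> e = {x, y}" for e :: "'b set"
    using inj_image_eq_iff[OF inj_Inr, of "{x, y}" e] by auto
  ultimately show ?thesis
    by (simp add: join_def disjoint_union_def image_iff)
qed

lemma edge_join_Inl_Inr:
  "{Inl x, Inr y} \<in> edges (join G G') \<longleftrightarrow> x \<in> verts G \<and> y \<in> verts G'"
proof -
  have "{Inl x, Inr y} \<noteq> Inl ` e" for e :: "'a set"
    by (metis Inr_Inl_False imageE insertI1 insertI2)
  moreover have "{Inl x, Inr y} \<noteq> Inr ` e" for e :: "'b set"
    by (metis Inl_Inr_False imageE insertI1)
  ultimately show ?thesis
    by (simp add: join_def disjoint_union_def image_iff doubleton_eq_iff)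
qed

lemma edge_H_Inl_Inl: "{Inl x, Inl y} \<in> edges (H n) \<longleftrightarrow> x < n \<and> y < n \<and> x \<noteq> y"
  unfolding H_def edge_join_Inl_Inl by (auto simp: complete_graph_def doubleton_eq_iff)

lemma edge_H_Inr_Inr:
  "{Inr x, Inr y} \<in> edges (H n) \<longleftrightarrow>
     x < 5 \<and> y < 5 \<and> (y = (x + 1) mod 5 \<or> x = (y + 1) mod 5)"
proof -
  \<comment> \<open>The edge set of the 5-cycle bounds only \<open>i\<close>; this bounds its
    successor, so that both endpoints lie below 5.\<close>
  have "Suc i mod 5 < 5" for i :: nat by simp
  then show ?thesis
    unfolding H_def edge_join_Inr_Inr cycle_graph_def
    by (auto simp: doubleton_eq_iff)
qed

lemma edge_H_Inl_Inr: "{Inl x, Inr y} \<in> edges (H n) \<longleftrightarrow> x < n \<and> y < 5"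
  unfolding H_def edge_join_Inl_Inr by (simp add: complete_graph_def cycle_graph_def)

text \<open>The simplifier matches a pair in the order written, so the reversed mixed pair gets its
  own rule.\<close>

lemma edge_H_Inr_Inl: "{Inr y, Inl x} \<in> edges (H n) \<longleftrightarrow> x < n \<and> y < 5"
  using edge_H_Inl_Inr[of x y n] by (simp add: insert_commute)

lemmas edge_H = edge_H_Inl_Inl edge_H_Inr_Inr edge_H_Inl_Inr edge_H_Inr_Inl

section \<open>The 5-cycle and the clique number\<close>

lemma less_5_cases:
  fixes x :: nat
  assumes "x < 5"
  obtains "x = 0" | "x = 1" | "x = 2" | "x = 3" | "x = 4"
  using assms by linarith

text \<open>Going round a triangle would add up three terms 1 or -1 to a multiple of 5, but such a
  sum is -3, -1, 1 or 3. The proof just checks all 125 triples.\<close>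

lemma C5_triangle_free:
  fixes x y z :: nat
  assumes "x < 5" "y < 5" "z < 5"
    and "y = (x + 1) mod 5 \<or> x = (y + 1) mod 5"
    and "z = (y + 1) mod 5 \<or> y = (z + 1) mod 5"
    and "z = (x + 1) mod 5 \<or> x = (z + 1) mod 5"
  shows False
  by (insert assms(4-6); rule less_5_cases[OF assms(1)]; rule less_5_cases[OF assms(2)];
      rule less_5_cases[OF assms(3)]) simp_all

text \<open>The colours run 0, 1, 0, 1, 2: strict alternation would clash on the closing edge
  between 4 and 0, so vertex 4 gets a third colour.\<close>

lemma C5_colouring:
  fixes i j :: nat
  assumes "i < 5" "j < 5" "j = (i + 1) mod 5 \<or> i = (j + 1) mod 5"
  shows "(if i = 4 then 2 else i mod 2) \<noteq> (if j = 4 then 2 else j mod 2)"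
  by (insert assms(3); rule less_5_cases[OF assms(1)]; rule less_5_cases[OF assms(2)]) simp_all

text \<open>This turns triangle-freeness of the 5-cycle into a bound on the part of a clique that
  lies in it.\<close>

lemma card_le_2_if_no_three_distinct:
  assumes "\<And>x y z. \<lbrakk>x \<in> A; y \<in> A; z \<in> A; x \<noteq> y; x \<noteq> z; y \<noteq> z\<rbrakk> \<Longrightarrow> False"
  shows "card A \<le> 2"
proof (rule ccontr)
  assume "\<not> card A \<le> 2"
  then have "3 \<le> card A" by simp
  then obtain B where "B \<subseteq> A" "card B = 3"
    by (rule obtain_subset_with_card_n)
  then obtain x y z where "B = {x, y, z}" "x \<noteq> y" "x \<noteq> z" "y \<noteq> z"
    by (auto simp: card_3_iff)
  then show False
    using assms[of x y z] \<open>B \<subseteq> A\<close> by simp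
qed

lemma card_clique_H_le:
  assumes "is_clique (H n) C"
  shows "card C \<le> n + 2"
proof -
  define A where "A = {x. Inl x \<in> C}"
  define B where "B = {y. Inr y \<in> C}"
  have C: "C = Inl ` A \<union> Inr ` B"
  proof (rule set_eqI)
    show "x \<in> C \<longleftrightarrow> x \<in> Inl ` A \<union> Inr ` B" for x
      by (cases x) (auto simp: A_def B_def)
  qed
  have sub: "A \<subseteq> {..<n}" "B \<subseteq> {..<5}"
    using assms by (auto simp: A_def B_def is_clique_def verts_H)
  have adj: "y = (x + 1) mod 5 \<or> x = (y + 1) mod 5" if "x \<in> B" "y \<in> B" "x \<noteq> y" for x y
  proof -
    have "{Inr x, Inr y} \<in> edges (H n)"
      using assms that by (auto simp: B_def is_clique_def)
    then show ?thesis by (simp add: edge_H)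
  qed
  have "card B \<le> 2"
  proof (rule card_le_2_if_no_three_distinct)
    fix x y z assume *: "x \<in> B" "y \<in> B" "z \<in> B" "x \<noteq> y" "x \<noteq> z" "y \<noteq> z"
    have "x < 5" "y < 5" "z < 5" using * sub by auto
    then show False
      using C5_triangle_free[of x y z] adj * by blast
  qed
  moreover have "card A \<le> n"
    using card_mono[OF _ sub(1)] by simp
  moreover have "card C \<le> card A + card B"
    unfolding C by (rule order_trans[OF card_Un_le]) (simp add: card_image)
  ultimately show ?thesis by linarith
qed

lemma clique_number_H: "clique_number (H n) = n + 2"
  unfolding clique_number_def
proof (rule Max_eqI)
  show "finite {card C | C. is_clique (H n) C}"
    by (rule finite_clique_sizes[OF simple_graph_H])
  show "m \<le> n + 2" if "m \<in> {card C | C. is_clique (H n) C}" for m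
    using that card_clique_H_le by auto
  \<comment> \<open>The bound is attained by all of K_n together with the edge between 0 and 1 of
    the 5-cycle.\<close>
  define C where "C = (Inl ` {..<n} \<union> Inr ` {0, 1} :: (nat + nat) set)"
  have "is_clique (H n) C"
    by (auto simp: is_clique_def C_def verts_H edge_H)
  moreover have "card C = n + 2"
    unfolding C_def by (subst card_Un_disjoint) (auto simp: card_image)
  ultimately show "n + 2 \<in> {card C | C. is_clique (H n) C}"
    by force
qed

section \<open>Chromatic number\<close>

lemma proper_colouring_H_ge:
  assumes "proper_colouring (H n) N c"
  shows "n + 3 \<le> N"
proof -
  have bound: "c x < N" if "x \<in> verts (H n)" for x
    using assms that by (simp add: proper_colouring_def)
  have neq: "c x \<noteq> c y" if "x \<in> verts (H n)" "y \<in> verts (H n)" "{x, y} \<in> edges (H n)" for x y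
    using assms that by (simp add: proper_colouring_def)
  define A where "A = c ` Inl ` {..<n}"
  define B where "B = c ` Inr ` {..<5}"
  have "inj_on c (Inl ` {..<n})"
  proof (rule inj_onI)
    fix x y :: "nat + nat"
    assume "x \<in> Inl ` {..<n}" "y \<in> Inl ` {..<n}" "c x = c y"
    moreover from this have "x \<noteq> y \<Longrightarrow> {x, y} \<in> edges (H n)"
      by (auto simp: edge_H)
    ultimately show "x = y"
      using neq[of x y] by (auto simp: verts_H)
  qed
  then have A: "card A = n"
    by (simp add: A_def card_image)
  have "{..<5::nat} = {0, 1, 2, 3, 4}" by auto
  then have "B = {c (Inr 0), c (Inr 1), c (Inr 2), c (Inr 3), c (Inr 4)}"
    by (simp add: B_def)
  \<comment> \<open>These are the five edges of the cycle. Two colours cannot alternate round an odd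
    cycle; \<open>card_insert_if\<close> reduces this to a case split on which of the five colours
    coincide.\<close>
  moreover have "c (Inr 0) \<noteq> c (Inr 1)" "c (Inr 1) \<noteq> c (Inr 2)" "c (Inr 2) \<noteq> c (Inr 3)"
    "c (Inr 3) \<noteq> c (Inr 4)" "c (Inr 4) \<noteq> c (Inr 0)"
    by (rule neq; simp add: verts_H edge_H)+
  ultimately have B: "3 \<le> card B"
    by (auto simp: card_insert_if)
  have "A \<inter> B = {}"
  proof -
    have "c (Inl x) \<noteq> c (Inr y)" if "x < n" "y < 5" for x y
      using that by (intro neq) (auto simp: verts_H edge_H)
    then show ?thesis by (auto simp: A_def B_def)
  qed
  then have "card (A \<union> B) = card A + card B"
    by (intro card_Un_disjoint) (simp_all add: A_def B_def)
  moreover have "card (A \<union> B) \<le> card {..<N}"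
    by (rule card_mono) (auto simp: A_def B_def verts_H intro!: bound)
  ultimately show ?thesis using A B by simp
qed

lemma chromatic_number_H: "chromatic_number (H n) = n + 3"
  unfolding chromatic_number_def
proof (rule Least_equality)
  \<comment> \<open>K_n takes the colours below \<open>n\<close>, one each, and the 5-cycle takes
    its three colours shifted by \<open>n\<close>. Hence only edges inside the 5-cycle need an
    argument below.\<close>
  define c where "c = case_sum (\<lambda>x. x) (\<lambda>y. n + (if y = 4 then 2 else y mod 2))"
  have "c x < n + 3" if "x \<in> verts (H n)" for x
    using that by (auto simp: c_def verts_H)
  moreover have "c x \<noteq> c y" if "x \<in> verts (H n)" "y \<in> verts (H n)" "{x, y} \<in> edges (H n)" for x y
  proof (cases x; cases y)
    fix i j assume x: "x = Inr i" and y: "y = Inr j"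
    then have "i < 5" "j < 5" "j = (i + 1) mod 5 \<or> i = (j + 1) mod 5"
      using that by (auto simp: edge_H)
    then show ?thesis
      using C5_colouring[of i j] by (simp add: x y c_def)
  qed (use that in \<open>auto simp: c_def edge_H\<close>)
  ultimately show "\<exists>c. proper_colouring (H n) (n + 3) c"
    by (auto simp: proper_colouring_def)
qed (auto intro: proper_colouring_H_ge)

section \<open>Cycle lengths\<close>

lemma cycle_length_H_le:
  assumes "is_cycle (H n) p"
  shows "length p \<le> n + 5"
proof -
  have "card (set p) \<le> card (verts (H n))"
    using assms simple_graph_H[of n] by (auto simp: is_cycle_def simple_graph_def intro: card_mono)
  then show ?thesis
    using assms by (simp add: is_cycle_def distinct_card card_verts_H)
qed

lemma cycle_H_exists:
  assumes "1 \<le> n" "3 \<le> m" "m \<le> n + 5"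
  shows "\<exists>p. is_cycle (H n) p \<and> length p = m"
proof -
  \<comment> \<open>Take as many vertices of K_n as possible while leaving at least one for the
    5-cycle. Then \<open>b\<close> is 1 or \<open>m - n\<close>, hence at most 5, and both parts are
    nonempty.\<close>
  define a where "a = min n (m - 1)"
  define b where "b = m - a"
  have ab: "1 \<le> a" "a \<le> n" "1 \<le> b" "b \<le> 5" "a + b = m"
    using assms by (auto simp: a_def b_def)
  define p where "p = (map Inl [0..<a] @ map Inr [0..<b] :: (nat + nat) list)"
  have len: "length p = m"
    using ab by (simp add: p_def)
  have nth: "p ! i = (if i < a then Inl i else Inr (i - a))" if "i < m" for i
    using that ab by (auto simp: p_def nth_append)
  have edge: "{p ! i, p ! ((i + 1) mod m)} \<in> edges (H n)" if "i < m" for i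
  proof (cases "i + 1 = m")
    case True
    \<comment> \<open>The closing edge runs from the last vertex, in the 5-cycle, back to
      \<open>Inl 0\<close>; as both parts are nonempty, it is a mixed edge.\<close>
    then have "p ! i = Inr (i - a)" "p ! ((i + 1) mod m) = Inl 0" "i - a < 5"
      using ab nth[of i] nth[of 0] by auto
    then show ?thesis
      using ab by (simp add: edge_H)
  next
    case False
    then have "i + 1 < m" using that by simp
    \<comment> \<open>Inside the second part the indices increase by 1 and stay below
      \<open>b\<close>, hence below 5, so the reduction mod 5 has no effect there.\<close>
    then show ?thesis
      using ab nth[of i] nth[of "i + 1"] by (auto simp: edge_H Suc_diff_le)
  qed
  have "distinct p" "set p \<subseteq> verts (H n)"
    using ab by (auto simp: p_def distinct_map verts_H)
  then have "is_cycle (H n) p"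
    using edge assms(2) by (simp add: is_cycle_def len)
  then show ?thesis using len by blast
qed

lemma even_cycle_lengths_H:
  assumes "1 \<le> n"
  shows "even_cycle_lengths (H n) = {m. even m \<and> 3 \<le> m \<and> m \<le> n + 5}"
  using assms cycle_H_exists[of n] cycle_length_H_le[of n]
  by (auto simp: even_cycle_lengths_def) (simp add: is_cycle_def)

theorem mainTheorem9:
  fixes k :: nat
  assumes "k \<ge> 2"
  shows "clique_number (H (2 * k - 2)) = 2 * k
    \<and> 2 * card (even_cycle_lengths (H (2 * k - 2))) + 2 = longest_even_cycle (H (2 * k - 2))
    \<and> longest_even_cycle (H (2 * k - 2)) = 2 * k + 2
    \<and> chromatic_number (H (2 * k - 2)) = 2 * k + 1
    \<and> 2 * k + 1 = 2 * card (even_cycle_lengths (H (2 * k - 2))) + 1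
    \<and> 2 * card (even_cycle_lengths (H (2 * k - 2))) + 1 = longest_even_cycle (H (2 * k - 2)) - 1
    \<and> clique_number (H (2 * k - 2)) = 2 * card (even_cycle_lengths (H (2 * k - 2)))
    \<and> chromatic_number (H (2 * k - 2)) = 2 * card (even_cycle_lengths (H (2 * k - 2))) + 1"
proof -
  have "even_cycle_lengths (H (2 * k - 2)) = {m. even m \<and> 3 \<le> m \<and> m \<le> 2 * k - 2 + 5}"
    using assms by (intro even_cycle_lengths_H) simp
  \<comment> \<open>The upper bound equals \<open>2 * k + 3\<close>, which is odd, so the even
    lengths run from 4 to \<open>2 * k + 2\<close>; halving them gives the \<open>k\<close> numbers
    from 2 to \<open>k + 1\<close>.\<close>
  also have "\<dots> = (*) 2 ` {2..k + 1}"
    using assms by (auto elim!: evenE)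
  finally have E: "even_cycle_lengths (H (2 * k - 2)) = (*) 2 ` {2..k + 1}" .
  have "card (even_cycle_lengths (H (2 * k - 2))) = k"
    unfolding E by (subst card_image) (auto simp: inj_on_def)
  moreover have "longest_even_cycle (H (2 * k - 2)) = 2 * k + 2"
    unfolding longest_even_cycle_def E
    by (rule Max_eqI) (use assms in \<open>auto intro: rev_image_eqI[of "k + 1"]\<close>)
  ultimately show ?thesis
    using assms by (simp add: clique_number_H chromatic_number_H)
qed

end
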